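(* Let $C=(V,E)$ be a flat-foldable crease pattern whose MV-assignments are determined by its origami line graph $C_L$, and let $n$ be the number of connected components of $C_L$. Then the number of MV-assignments of $C$ that locally fold flat is $2^n$.
   Context: A crease pattern $C=(V,E)$ is a (finite) planar graph drawn with straight edges on a piece of paper (a region of the plane); its vertices are partitioned as $V=V_B\cup V_I$ into those on the boundary of the paper and those in its interior, and the edges in $E$ are the crease lines. A mountain-valley (MV) assignment is a function $\mu:E\to\{-1,1\}$, where $-1$ means valley and $1$ means mountain. An MV-assignment $\mu$ is valid if all creases of $C$ can be folded, with the mountains and valleys specified by $\mu$, to transform the paper in a piecewise isometric manner into a flat object without self-intersection of the paper. The crease pattern $C$ is flat-foldable if it admits a valid MV-assignment. An MV-assignment $\mu$ locally folds flat if, for each interior vertex $v\in V_I$, a small disk around $v$ (containing no other vertex and only the creases meeting at $v$) folds flat without self-intersection using the mountains and valleys given by $\mu$. In particular, every valid MV-assignment locally folds flat. Two creases $c_i,c_j\in E$ are forced to have different (respectively, the same) MV parity if $\mu(c_i)\neq\mu(c_j)$ (respectively, $\mu(c_i)=\mu(c_j)$) for every MV-assignment $\mu$ of $C$ that locally folds flat. The origami line graph $C_L=(V_L,E_L)$ of a flat-foldable crease pattern $C$ is produced as follows. Start with $V_L=E=\{c_1,\dots,c_k\}$, the set of creases, and no edges. Step 1: for every pair of distinct creases $c_i,c_j$ that are forced to have different MV parity, put $\{c_i,c_j\}\in E_L$. Step 2: for every pair of distinct creases $c_i,c_j$ that are forced to have the same MV parity and that are not already the ends of a path of even length in the graph obtained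 from Step 1, add a new vertex $v_{i,j}$ to $V_L$ and put $\{c_i,v_{i,j}\},\{v_{i,j},c_j\}\in E_L$. The MV-assignments of $C$ are determined by $C_L$ if every MV-assignment $\mu$ of $C$ that locally folds flat corresponds to a unique proper 2-vertex coloring of $C_L$ with colors $\{-1,1\}$ and vice versa; that is, restricting a coloring to the vertices of $C_L$ that are creases is a bijection from the proper 2-vertex colorings $V_L\to\{-1,1\}$ of $C_L$ to the MV-assignments of $C$ that locally fold flat. *)

theory Defs
  imports "HOL-Analysis.Analysis"
begin

text \<open>
  The plane is \<^typ>\<open>complex\<close>. A crease is the two-element set of its end points; it is drawn as the
  segment \<^term>\<open>convex hull e\<close>, with relative interior \<open>crease_line e\<close>.
\<close>

definition crease_line :: "complex set \<Rightarrow> complex set" where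
  "crease_line e = convex hull e - e"

text \<open>
  The paper \<open>P\<close> is a closed region. Wherever a crease meets the boundary of the paper or another
  crease there is a vertex, so the relative interiors of the creases run through the interior of the
  paper, avoid all vertices and are pairwise disjoint.
\<close>

definition crease_pattern :: "complex set \<Rightarrow> complex set \<Rightarrow> complex set set \<Rightarrow> bool" where
  "crease_pattern P V E \<longleftrightarrow>
     interior P \<noteq> {} \<and> connected (interior P) \<and> P = closure (interior P) \<and>
     finite V \<and> V \<subseteq> P \<and>
     (\<forall>e\<in>E. \<exists>u\<in>V. \<exists>v\<in>V. u \<noteq> v \<and> e = {u, v}) \<and>
     (\<forall>e\<in>E. crease_line e \<subseteq> interior P - V) \<and>
     disjoint_family_on crease_line E"

definition interior_vertices :: "complex set \<Rightarrow> complex set \<Rightarrow> complex set" where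
  "interior_vertices P V = V \<inter> interior P"

definition MV_assignments :: "complex set set \<Rightarrow> (complex set \<Rightarrow> int) set" where
  "MV_assignments E = E \<rightarrow>\<^sub>E {-1, 1}"

text \<open>
  Flat folding of a piece of paper \<open>D\<close> along those parts of the creases in \<open>E\<close> that lie in \<open>D\<close>.
  The folding map \<open>f\<close> takes values in the plane again; the points where the orientation of the paper
  is preserved have the top side of the paper facing up, the others have it facing down.
\<close>

definition face_points :: "complex set \<Rightarrow> complex set set \<Rightarrow> complex set" where
  "face_points D E = interior D - (\<Union>e\<in>E. convex hull e)"

definition crease_points :: "complex set \<Rightarrow> complex set set \<Rightarrow> complex set" where
  "crease_points D E = interior D \<inter> (\<Union>e\<in>E. crease_line e)"

definition faces_up :: "(complex \<Rightarrow> complex) \<Rightarrow> complex \<Rightarrow> bool" where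
  "faces_up f p \<longleftrightarrow> (\<exists>a b. norm a = 1 \<and> (\<forall>\<^sub>F z in nhds p. f z = a * z + b))"

definition faces_down :: "(complex \<Rightarrow> complex) \<Rightarrow> complex \<Rightarrow> bool" where
  "faces_down f p \<longleftrightarrow> (\<exists>a b. norm a = 1 \<and> (\<forall>\<^sub>F z in nhds p. f z = a * cnj z + b))"

text \<open>
  \<open>f\<close> is continuous, a rigid motion on every face, and every crease is actually folded: it is
  bordered by paper facing up and by paper facing down.
\<close>

definition folding_map ::
    "complex set \<Rightarrow> complex set set \<Rightarrow> (complex \<Rightarrow> complex) \<Rightarrow> bool" where
  "folding_map D E f \<longleftrightarrow>
     continuous_on D f \<and>
     (\<forall>p\<in>face_points D E. faces_up f p \<or> faces_down f p) \<and>
     (\<forall>x\<in>crease_points D E.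
        x \<in> closure {p \<in> face_points D E. faces_up f p} \<and>
        x \<in> closure {p \<in> face_points D E. faces_down f p})"

text \<open>
  Absence of self-intersection is expressed by a layer order: \<open>below p q\<close> means that in the folded
  state the paper at \<open>p\<close> lies below the paper at \<open>q\<close>, and is relevant only for face points with
  \<open>f p = f q\<close>. The conjuncts say, in turn: the layers over each point of the plane are linearly
  ordered; the order does not change within two overlapping faces; near a crease point \<open>x\<close> lying
  over (or under) a face point \<open>t\<close>, the layer of \<open>t\<close> does not pass between the two layers joined at
  \<open>x\<close>; and near two crease points \<open>x\<close>, \<open>x'\<close> with the same image, the two pairs of layers joined at
  \<open>x\<close> and at \<open>x'\<close> do not interleave. Vertices need no separate condition, since a crossing at a
  vertex would show up at nearby points of the faces or creases.
\<close>

definition layer_order ::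
    "complex set \<Rightarrow> complex set set \<Rightarrow> (complex \<Rightarrow> complex) \<Rightarrow> (complex \<Rightarrow> complex \<Rightarrow> bool) \<Rightarrow> bool"
  where
  "layer_order D E f below \<longleftrightarrow>
     (\<forall>y. let Y = {p \<in> face_points D E. f p = y}
          in irreflp_on Y below \<and> transp_on Y below \<and> totalp_on Y below) \<and>
     (\<forall>p\<in>face_points D E. \<forall>q\<in>face_points D E. f p = f q \<and> below p q \<longrightarrow>
        (\<forall>\<^sub>F (p', q') in nhds (p, q). f p' = f q' \<longrightarrow> below p' q')) \<and>
     (\<forall>x\<in>crease_points D E. \<forall>t\<in>face_points D E. f x = f t \<longrightarrow>
        (\<forall>\<^sub>F (p, q, r) in nhds (x, x, t).
           p \<in> face_points D E \<and> q \<in> face_points D E \<and> f p = f q \<and> f q = f r \<longrightarrow>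
           (below p r \<longleftrightarrow> below q r))) \<and>
     (\<forall>x\<in>crease_points D E. \<forall>x'\<in>crease_points D E. x \<noteq> x' \<and> f x = f x' \<longrightarrow>
        (\<forall>\<^sub>F (p, q, p', q') in nhds (x, x, x', x').
           {p, q, p', q'} \<subseteq> face_points D E \<and> f p = f q \<and> f q = f p' \<and> f p' = f q' \<longrightarrow>
           \<not> (below p p' \<and> below p' q \<and> below q q')))"

text \<open>
  At a valley the top sides of the two layers face each other: the layer facing up is the lower one.
  At a mountain it is the upper one.
\<close>

definition has_MV ::
    "complex set \<Rightarrow> complex set set \<Rightarrow> (complex \<Rightarrow> complex) \<Rightarrow> (complex \<Rightarrow> complex \<Rightarrow> bool) \<Rightarrow>
     (complex set \<Rightarrow> int) \<Rightarrow> bool" where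
  "has_MV D E f below \<mu> \<longleftrightarrow>
     (\<forall>e\<in>E. \<forall>x\<in>interior D \<inter> crease_line e.
        \<forall>\<^sub>F (p, q) in nhds (x, x).
          p \<in> face_points D E \<and> q \<in> face_points D E \<and> f p = f q \<and>
          faces_up f p \<and> faces_down f q \<longrightarrow>
          (\<mu> e = -1 \<longrightarrow> below p q) \<and> (\<mu> e = 1 \<longrightarrow> below q p))"

definition folds_flat :: "complex set \<Rightarrow> complex set set \<Rightarrow> (complex set \<Rightarrow> int) \<Rightarrow> bool" where
  "folds_flat D E \<mu> \<longleftrightarrow>
     (\<exists>f below. folding_map D E f \<and> layer_order D E f below \<and> has_MV D E f below \<mu>)"

definition valid_MVs :: "complex set \<Rightarrow> complex set set \<Rightarrow> (complex set \<Rightarrow> int) set" where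
  "valid_MVs P E = {\<mu> \<in> MV_assignments E. folds_flat P E \<mu>}"

definition flat_foldable :: "complex set \<Rightarrow> complex set set \<Rightarrow> bool" where
  "flat_foldable P E \<longleftrightarrow> valid_MVs P E \<noteq> {}"

definition locally_folds_flat ::
    "complex set \<Rightarrow> complex set \<Rightarrow> complex set set \<Rightarrow> (complex set \<Rightarrow> int) \<Rightarrow> bool" where
  "locally_folds_flat P V E \<mu> \<longleftrightarrow>
     (\<forall>v\<in>interior_vertices P V. \<exists>r>0.
        cball v r \<subseteq> interior P \<and> cball v r \<inter> V = {v} \<and>
        (\<forall>e\<in>E. v \<notin> e \<longrightarrow> convex hull e \<inter> cball v r = {}) \<and>
        folds_flat (cball v r) E \<mu>)"

definition local_MVs ::
    "complex set \<Rightarrow> complex set \<Rightarrow> complex set set \<Rightarrow> (complex set \<Rightarrow> int) set" where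
  "local_MVs P V E = {\<mu> \<in> MV_assignments E. locally_folds_flat P V E \<mu>}"

definition forced_different ::
    "complex set \<Rightarrow> complex set \<Rightarrow> complex set set \<Rightarrow> complex set \<Rightarrow> complex set \<Rightarrow> bool" where
  "forced_different P V E c d \<longleftrightarrow> (\<forall>\<mu>\<in>local_MVs P V E. \<mu> c \<noteq> \<mu> d)"

definition forced_same ::
    "complex set \<Rightarrow> complex set \<Rightarrow> complex set set \<Rightarrow> complex set \<Rightarrow> complex set \<Rightarrow> bool" where
  "forced_same P V E c d \<longleftrightarrow> (\<forall>\<mu>\<in>local_MVs P V E. \<mu> c = \<mu> d)"

text \<open>Simple undirected graphs are given by their edge sets, edges being two-element sets.\<close>

definition graph_path :: "'a set set \<Rightarrow> 'a list \<Rightarrow> bool" where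
  "graph_path G xs \<longleftrightarrow> xs \<noteq> [] \<and> distinct xs \<and> successively (\<lambda>u v. {u, v} \<in> G) xs"

definition even_path_between :: "'a set set \<Rightarrow> 'a \<Rightarrow> 'a \<Rightarrow> bool" where
  "even_path_between G u v \<longleftrightarrow>
     (\<exists>xs. graph_path G xs \<and> hd xs = u \<and> last xs = v \<and> even (length xs - 1))"

definition graph_components :: "'a set \<Rightarrow> 'a set set \<Rightarrow> 'a set set" where
  "graph_components W G = W // {(u, v). u \<in> W \<and> v \<in> W \<and> (u, v) \<in> {(a, b). {a, b} \<in> G}\<^sup>*}"

definition proper_2_colorings :: "'a set \<Rightarrow> 'a set set \<Rightarrow> ('a \<Rightarrow> int) set" where
  "proper_2_colorings W G =
     {\<kappa> \<in> W \<rightarrow>\<^sub>E {-1, 1}. \<forall>u\<in>W. \<forall>v\<in>W. {u, v} \<in> G \<longrightarrow> \<kappa> u \<noteq> \<kappa> v}"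

text \<open>
  In the origami line graph the vertex of a crease \<open>c\<close> is \<open>Inl c\<close>, and the additional vertex for an
  unordered pair of creases \<open>c\<close>, \<open>d\<close> is \<open>Inr {c, d}\<close>.
\<close>

definition step1_edges ::
    "complex set \<Rightarrow> complex set \<Rightarrow> complex set set \<Rightarrow> complex set set set" where
  "step1_edges P V E = {{c, d} |c d. c \<in> E \<and> d \<in> E \<and> c \<noteq> d \<and> forced_different P V E c d}"

definition step2_pairs ::
    "complex set \<Rightarrow> complex set \<Rightarrow> complex set set \<Rightarrow> complex set set set" where
  "step2_pairs P V E =
     {{c, d} |c d. c \<in> E \<and> d \<in> E \<and> c \<noteq> d \<and> forced_same P V E c d \<and>
                   \<not> even_path_between (step1_edges P V E) c d}"

definition line_graph_vertices ::
    "complex set \<Rightarrow> complex set \<Rightarrow> complex set set \<Rightarrow> (complex set + complex set set) set" where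
  "line_graph_vertices P V E = Inl ` E \<union> Inr ` step2_pairs P V E"

definition line_graph_edges ::
    "complex set \<Rightarrow> complex set \<Rightarrow> complex set set \<Rightarrow> (complex set + complex set set) set set" where
  "line_graph_edges P V E =
     {{Inl c, Inl d} |c d. {c, d} \<in> step1_edges P V E} \<union>
     {{Inl c, Inr p} |c p. p \<in> step2_pairs P V E \<and> c \<in> p}"

definition determined_by_line_graph ::
    "complex set \<Rightarrow> complex set \<Rightarrow> complex set set \<Rightarrow> bool" where
  "determined_by_line_graph P V E \<longleftrightarrow>
     bij_betw (\<lambda>\<kappa>. restrict (\<lambda>c. \<kappa> (Inl c)) E)
       (proper_2_colorings (line_graph_vertices P V E) (line_graph_edges P V E))
       (local_MVs P V E)"

end

theory Submission
  imports Defs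
begin

text \<open>
  Two proper 2-colorings of a graph with colors \<open>-1\<close> and \<open>1\<close> have a pointwise product that does not
  change along an edge, because both factors change sign there. Hence, once one coloring \<open>\<kappa>\<^sub>0\<close> is
  fixed, the others are obtained from it by choosing a sign for each connected component, and a
  2-colorable finite graph with \<open>n\<close> components has exactly \<open>2 ^ n\<close> colorings
  (\<open>card_proper_2_colorings\<close>). The hypothesis that the assignments are determined by the line graph
  transfers this count to the assignments that locally fold flat.

  The remaining point is that a coloring exists at all. Were there no locally flat-folding
  assignment, every pair of creases would be vacuously forced to differ, so with three or more
  creases the line graph would be a complete graph without proper 2-colorings and still determine
  the (empty) set of assignments. Flat-foldability excludes this: a flat folding of the whole paper
  restricts to a flat folding of every small disk (\<open>folds_flat_subset\<close>), so a valid assignment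
  locally folds flat (\<open>valid_MVs_subset_local_MVs\<close>).
\<close>

section \<open>Counting proper 2-colorings\<close>

definition same_component :: "'a set \<Rightarrow> 'a set set \<Rightarrow> ('a \<times> 'a) set" where
  "same_component W G = {(u, v). u \<in> W \<and> v \<in> W \<and> (u, v) \<in> {(a, b). {a, b} \<in> G}\<^sup>*}"

lemma graph_components_eq_quotient: "graph_components W G = W // same_component W G"
  by (simp add: graph_components_def same_component_def)

lemma equiv_same_component: "equiv W (same_component W G)"
proof (rule equivI)
  show "same_component W G \<subseteq> W \<times> W"
    by (auto simp: same_component_def)
  show "refl_on W (same_component W G)"
    by (simp add: same_component_def refl_on_def)
  have "sym {(a, b). {a, b} \<in> G}"
    by (auto simp: sym_def insert_commute)
  then have "sym ({(a, b). {a, b} \<in> G}\<^sup>*)"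
    by (rule sym_rtrancl)
  then show "sym (same_component W G)"
    by (auto simp: same_component_def sym_def)
  show "trans (same_component W G)"
    by (auto simp: same_component_def trans_def)
qed

text \<open>
  Both colorings change sign along an edge, so their product is the same at its two ends, and then
  along every walk. That edges have their ends in \<open>W\<close> keeps the walk in the colored region.
\<close>

lemma coloring_product_constant_on_components:
  assumes "\<Union>G \<subseteq> W"
    and "\<kappa> \<in> proper_2_colorings W G" "\<nu> \<in> proper_2_colorings W G"
    and "(u, v) \<in> same_component W G"
  shows "\<kappa> u * \<nu> u = \<kappa> v * \<nu> v"
proof -
  have "(u, v) \<in> {(a, b). {a, b} \<in> G}\<^sup>*"
    using assms(4) by (simp add: same_component_def)
  then show ?thesis
  proof (induction rule: rtrancl_induct)
    case base
    show ?case ..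
  next
    case (step y z)
    then have edge: "{y, z} \<in> G" and "y \<in> W" "z \<in> W"
      using assms(1) by auto
    then have "\<kappa> y \<in> {-1, 1}" "\<kappa> z \<in> {-1, 1}" "\<kappa> y \<noteq> \<kappa> z"
      and "\<nu> y \<in> {-1, 1}" "\<nu> z \<in> {-1, 1}" "\<nu> y \<noteq> \<nu> z"
      using assms(2,3) by (auto simp: proper_2_colorings_def PiE_iff)
    then have "\<kappa> y * \<nu> y = \<kappa> z * \<nu> z"
      by auto
    with step.IH show ?case
      by simp
  qed
qed

text \<open>
  Twisting a fixed coloring \<open>\<kappa>\<^sub>0\<close> by one sign per component is the bijection between sign vectors and
  colorings; its inverse reads off the sign of a component as the product of the two colorings at any
  vertex of it.
\<close>

lemma bij_betw_component_signs_colorings: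
  assumes edges: "\<Union>G \<subseteq> W" and \<kappa>0: "\<kappa>0 \<in> proper_2_colorings W G"
  shows "bij_betw (\<lambda>\<phi>. \<lambda>u\<in>W. \<phi> (same_component W G `` {u}) * \<kappa>0 u)
           (graph_components W G \<rightarrow>\<^sub>E {-1, 1}) (proper_2_colorings W G)"
    (is "bij_betw ?twist ?S _")
proof -
  let ?R = "same_component W G"
  have eqv: "equiv W ?R"
    by (rule equiv_same_component)
  have comp: "?R `` {u} \<in> graph_components W G" if "u \<in> W" for u
    using that by (simp add: graph_components_eq_quotient quotientI)
  have \<kappa>0_sign: "\<kappa>0 u \<in> {-1, 1}" if "u \<in> W" for u
    using \<kappa>0 that by (auto simp: proper_2_colorings_def)
  show ?thesis
  proof (rule bij_betw_imageI)
    show "inj_on ?twist ?S"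
    proof (rule inj_onI)
      fix \<phi> \<psi> assume \<phi>: "\<phi> \<in> ?S" and \<psi>: "\<psi> \<in> ?S" and eq: "?twist \<phi> = ?twist \<psi>"
      show "\<phi> = \<psi>"
      proof (rule PiE_ext[OF \<phi> \<psi>])
        fix C assume "C \<in> graph_components W G"
        then obtain u where u: "u \<in> W" "C = ?R `` {u}"
          by (auto simp: graph_components_eq_quotient elim: quotientE)
        have "\<phi> C * \<kappa>0 u = \<psi> C * \<kappa>0 u"
          using fun_cong[OF eq, of u] u by simp
        then show "\<phi> C = \<psi> C"
          using \<kappa>0_sign[OF u(1)] by auto
      qed
    qed
    show "?twist ` ?S = proper_2_colorings W G"
    proof (intro equalityI subsetI)
      fix \<kappa> assume "\<kappa> \<in> ?twist ` ?S"
      then obtain \<phi> where \<phi>: "\<phi> \<in> ?S" and \<kappa>: "\<kappa> = ?twist \<phi>"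
        by auto
      have sign: "\<phi> (?R `` {u}) \<in> {-1, 1}" if "u \<in> W" for u
        using PiE_mem[OF \<phi> comp[OF that]] .
      have "?twist \<phi> u \<noteq> ?twist \<phi> v" if uv: "u \<in> W" "v \<in> W" "{u, v} \<in> G" for u v
      proof -
        have "(u, v) \<in> ?R"
          using uv by (auto simp: same_component_def)
        then have "?R `` {u} = ?R `` {v}"
          by (rule equiv_class_eq[OF eqv])
        moreover have "\<kappa>0 u \<noteq> \<kappa>0 v"
          using \<kappa>0 uv by (auto simp: proper_2_colorings_def)
        ultimately show ?thesis
          using sign[OF uv(2)] uv by auto
      qed
      moreover have "?twist \<phi> u \<in> {-1, 1}" if "u \<in> W" for u
        using sign[OF that] \<kappa>0_sign[OF that] that by auto
      ultimately show "\<kappa> \<in> proper_2_colorings W G"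
        unfolding \<kappa> proper_2_colorings_def by (auto simp: PiE_iff)
    next
      fix \<kappa> assume \<kappa>: "\<kappa> \<in> proper_2_colorings W G"
      have \<kappa>_sign: "\<kappa> u \<in> {-1, 1}" if "u \<in> W" for u
        using \<kappa> that by (auto simp: proper_2_colorings_def)
      define rep where "rep C = (SOME u. u \<in> C)" for C :: "'a set"
      have rep: "(u, rep (?R `` {u})) \<in> ?R" if "u \<in> W" for u
        using someI[of "\<lambda>v. v \<in> ?R `` {u}" u] equiv_class_self[OF eqv that]
        by (simp add: rep_def)
      define \<phi> where "\<phi> = (\<lambda>C\<in>graph_components W G. \<kappa> (rep C) * \<kappa>0 (rep C))"
      have \<phi>_class: "\<phi> (?R `` {u}) = \<kappa> u * \<kappa>0 u" if "u \<in> W" for u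
        using coloring_product_constant_on_components[OF edges \<kappa> \<kappa>0 rep[OF that]] comp[OF that]
        by (simp add: \<phi>_def)
      have "\<phi> \<in> ?S"
      proof (rule PiE_I)
        fix C assume "C \<in> graph_components W G"
        then obtain u where "u \<in> W" "C = ?R `` {u}"
          by (auto simp: graph_components_eq_quotient elim: quotientE)
        then show "\<phi> C \<in> {-1, 1}"
          using \<phi>_class[of u] \<kappa>_sign[of u] \<kappa>0_sign[of u] by auto
      qed (simp add: \<phi>_def)
      moreover have "?twist \<phi> = \<kappa>"
      proof
        fix u
        show "?twist \<phi> u = \<kappa> u"
        proof (cases "u \<in> W")
          case True
          then show ?thesis
            using \<phi>_class[OF True] \<kappa>0_sign[OF True] by auto
        next
          case False
          then show ?thesis
            using \<kappa> by (auto simp: proper_2_colorings_def PiE_def extensional_def)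
        qed
      qed
      ultimately show "\<kappa> \<in> ?twist ` ?S"
        by force
    qed
  qed
qed

lemma card_proper_2_colorings:
  assumes "finite W" "\<Union>G \<subseteq> W" "proper_2_colorings W G \<noteq> {}"
  shows "card (proper_2_colorings W G) = 2 ^ card (graph_components W G)"
proof -
  obtain \<kappa>0 where "\<kappa>0 \<in> proper_2_colorings W G"
    using assms(3) by auto
  from bij_betw_same_card[OF bij_betw_component_signs_colorings[OF assms(2) this]]
  have "card (proper_2_colorings W G) = card (graph_components W G \<rightarrow>\<^sub>E {-1, 1 :: int})"
    by simp
  moreover have "finite (graph_components W G)"
    unfolding graph_components_eq_quotient
    using assms(1) by (rule finite_quotient) (auto simp: same_component_def)
  ultimately show ?thesis
    by (simp add: card_PiE numeral_2_eq_2)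
qed

section \<open>Flat foldings restrict to smaller pieces of paper\<close>

lemma face_points_subset:
  assumes "D \<subseteq> P"
  shows "face_points D E = face_points P E \<inter> interior D"
  using interior_mono[OF assms] by (auto simp: face_points_def)

lemma crease_points_subset:
  assumes "D \<subseteq> P"
  shows "crease_points D E \<subseteq> crease_points P E"
  using interior_mono[OF assms] by (auto simp: crease_points_def)

text \<open>
  The requirement that a crease is really folded is local: a point of the interior of \<open>D\<close> that is a
  limit of face points of \<open>P\<close> is a limit of those lying in \<open>D\<close>.
\<close>

lemma folding_map_subset:
  assumes "folding_map P E f" "D \<subseteq> P"
  shows "folding_map D E f"
proof -
  have restrict_closure: "x \<in> closure {p \<in> face_points D E. Q p}"
    if "x \<in> interior D" "x \<in> closure {p \<in> face_points P E. Q p}" for x Q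
  proof -
    have "x \<in> closure (interior D \<inter> {p \<in> face_points P E. Q p})"
      using open_Int_closure_subset[of "interior D" "{p \<in> face_points P E. Q p}"] that by auto
    moreover have "interior D \<inter> {p \<in> face_points P E. Q p} = {p \<in> face_points D E. Q p}"
      by (auto simp: face_points_subset[OF assms(2)])
    ultimately show ?thesis
      by simp
  qed
  have "x \<in> closure {p \<in> face_points D E. faces_up f p} \<and>
        x \<in> closure {p \<in> face_points D E. faces_down f p}" if "x \<in> crease_points D E" for x
  proof -
    have "x \<in> interior D" "x \<in> crease_points P E"
      using that crease_points_subset[OF assms(2)] by (auto simp: crease_points_def)
    then show ?thesis
      using assms(1) restrict_closure by (auto simp: folding_map_def)
  qed
  moreover have "continuous_on D f"
    using assms by (auto simp: folding_map_def intro: continuous_on_subset)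
  ultimately show ?thesis
    using assms(1) by (auto simp: folding_map_def face_points_subset[OF assms(2)])
qed

lemma layer_order_subset:
  assumes "layer_order P E f below" "D \<subseteq> P"
  shows "layer_order D E f below"
proof -
  have face: "face_points D E \<subseteq> face_points P E"
    by (auto simp: face_points_subset[OF assms(2)])
  note crease = crease_points_subset[OF assms(2), of E]
  show ?thesis
    unfolding layer_order_def
  proof (intro conjI allI ballI impI, goal_cases)
    case (1 y)
    have "{p \<in> face_points D E. f p = y} \<subseteq> {p \<in> face_points P E. f p = y}"
      using face by auto
    moreover have "irreflp_on {p \<in> face_points P E. f p = y} below"
      "transp_on {p \<in> face_points P E. f p = y} below"
      "totalp_on {p \<in> face_points P E. f p = y} below"
      using assms(1) by (auto simp: layer_order_def Let_def)
    ultimately show ?case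
      by (auto simp: Let_def intro: irreflp_on_subset transp_on_subset totalp_on_subset)
  next
    case (2 p q)
    then show ?case
      using assms(1) face unfolding layer_order_def by blast
  next
    case (3 x t)
    then have "\<forall>\<^sub>F (p, q, r) in nhds (x, x, t).
       p \<in> face_points P E \<and> q \<in> face_points P E \<and> f p = f q \<and> f q = f r \<longrightarrow>
       (below p r \<longleftrightarrow> below q r)"
      using assms(1) face crease unfolding layer_order_def by blast
    then show ?case
      by (rule eventually_mono) (use face in auto)
  next
    case (4 x x')
    then have "\<forall>\<^sub>F (p, q, p', q') in nhds (x, x, x', x').
       {p, q, p', q'} \<subseteq> face_points P E \<and> f p = f q \<and> f q = f p' \<and> f p' = f q' \<longrightarrow>
       \<not> (below p p' \<and> below p' q \<and> below q q')"
      using assms(1) crease unfolding layer_order_def by blast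
    then show ?case
      by (rule eventually_mono) (use face in auto)
  qed
qed

lemma has_MV_subset:
  assumes "has_MV P E f below \<mu>" "D \<subseteq> P"
  shows "has_MV D E f below \<mu>"
  unfolding has_MV_def
proof (intro ballI)
  fix e x assume "e \<in> E" "x \<in> interior D \<inter> crease_line e"
  then have "\<forall>\<^sub>F (p, q) in nhds (x, x).
      p \<in> face_points P E \<and> q \<in> face_points P E \<and> f p = f q \<and> faces_up f p \<and> faces_down f q \<longrightarrow>
      (\<mu> e = -1 \<longrightarrow> below p q) \<and> (\<mu> e = 1 \<longrightarrow> below q p)"
    using assms(1) interior_mono[OF assms(2)] unfolding has_MV_def by blast
  then show "\<forall>\<^sub>F (p, q) in nhds (x, x).
      p \<in> face_points D E \<and> q \<in> face_points D E \<and> f p = f q \<and> faces_up f p \<and> faces_down f q \<longrightarrow>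
      (\<mu> e = -1 \<longrightarrow> below p q) \<and> (\<mu> e = 1 \<longrightarrow> below q p)"
    by (rule eventually_mono) (auto simp: face_points_subset[OF assms(2)])
qed

text \<open>
  Every condition on a folding map and its layer order is either universal over points of the paper
  or local at a point, so the same map and order serve for the smaller piece.
\<close>

lemma folds_flat_subset:
  assumes "folds_flat P E \<mu>" "D \<subseteq> P"
  shows "folds_flat D E \<mu>"
  using assms folding_map_subset layer_order_subset has_MV_subset
  unfolding folds_flat_def by meson

section \<open>Valid assignments locally fold flat\<close>

lemma finite_creases:
  assumes "crease_pattern P V E"
  shows "finite E"
proof (rule finite_subset)
  show "E \<subseteq> Pow V" "finite (Pow V)"
    using assms by (fastforce simp: crease_pattern_def)+
qed

text \<open>
  A vertex lies on no crease other than those it bounds, and these finitely many other creases and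
  vertices form a closed set, so they keep a positive distance.
\<close>

lemma isolating_disk_exists:
  assumes "crease_pattern P V E" "v \<in> interior_vertices P V"
  obtains r where "r > 0" "cball v r \<subseteq> interior P" "cball v r \<inter> V = {v}"
    "\<And>e. e \<in> E \<Longrightarrow> v \<notin> e \<Longrightarrow> convex hull e \<inter> cball v r = {}"
proof -
  have v: "v \<in> V" "v \<in> interior P"
    using assms(2) by (auto simp: interior_vertices_def)
  have "finite V"
    using assms(1) by (simp add: crease_pattern_def)
  define A where "A = (V - {v}) \<union> (\<Union>e\<in>{e \<in> E. v \<notin> e}. convex hull e)"
  have "closed (convex hull e)" if "e \<in> E" for e
  proof -
    have "finite e"
      using assms(1) that by (auto simp: crease_pattern_def)
    then show ?thesis
      by (simp add: compact_imp_closed finite_imp_compact compact_convex_hull)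
  qed
  then have "closed A"
    unfolding A_def using \<open>finite V\<close> finite_creases[OF assms(1)]
    by (intro closed_Un closed_UN) (auto intro: finite_imp_closed)
  moreover have "v \<notin> A"
  proof -
    have "crease_line e \<subseteq> interior P - V" if "e \<in> E" for e
      using assms(1) that by (simp add: crease_pattern_def)
    then show ?thesis
      using v(1) by (auto simp: A_def crease_line_def)
  qed
  ultimately have "open (interior P - A)" "v \<in> interior P - A"
    using v by (auto intro: open_Diff)
  then obtain r where r: "r > 0" "cball v r \<subseteq> interior P - A"
    using open_contains_cball by blast
  show thesis
  proof (rule that)
    show "r > 0" "cball v r \<subseteq> interior P"
      using r by auto
    show "cball v r \<inter> V = {v}"
      using r v(1) by (auto simp: A_def)
    show "convex hull e \<inter> cball v r = {}" if "e \<in> E" "v \<notin> e" for e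
      using r(2) that by (auto simp: A_def)
  qed
qed

lemma valid_MVs_subset_local_MVs:
  assumes "crease_pattern P V E"
  shows "valid_MVs P E \<subseteq> local_MVs P V E"
proof
  fix \<mu> assume \<mu>: "\<mu> \<in> valid_MVs P E"
  have "locally_folds_flat P V E \<mu>"
    unfolding locally_folds_flat_def
  proof
    fix v assume "v \<in> interior_vertices P V"
    then obtain r where r: "r > 0" "cball v r \<subseteq> interior P" "cball v r \<inter> V = {v}"
      "\<And>e. e \<in> E \<Longrightarrow> v \<notin> e \<Longrightarrow> convex hull e \<inter> cball v r = {}"
      using isolating_disk_exists[OF assms] by blast
    have "cball v r \<subseteq> P"
      using r(2) interior_subset by blast
    then have "folds_flat (cball v r) E \<mu>"
      using \<mu> folds_flat_subset by (auto simp: valid_MVs_def)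
    with r show "\<exists>r>0. cball v r \<subseteq> interior P \<and> cball v r \<inter> V = {v} \<and>
        (\<forall>e\<in>E. v \<notin> e \<longrightarrow> convex hull e \<inter> cball v r = {}) \<and> folds_flat (cball v r) E \<mu>"
      by blast
  qed
  with \<mu> show "\<mu> \<in> local_MVs P V E"
    by (simp add: valid_MVs_def local_MVs_def)
qed

section \<open>Counting locally flat-folding assignments\<close>

lemma step2_pairs_subset: "step2_pairs P V E \<subseteq> Pow E"
  by (auto simp: step2_pairs_def)

lemma finite_line_graph_vertices:
  assumes "finite E"
  shows "finite (line_graph_vertices P V E)"
  using assms finite_subset[OF step2_pairs_subset[of P V E]]
  by (simp add: line_graph_vertices_def)

lemma line_graph_edges_subset: "\<Union>(line_graph_edges P V E) \<subseteq> line_graph_vertices P V E"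
proof -
  have "c \<in> E \<and> d \<in> E" if "{c, d} \<in> step1_edges P V E" for c d
    using that by (auto simp: step1_edges_def doubleton_eq_iff)
  then show ?thesis
    using step2_pairs_subset[of P V E]
    by (fastforce simp: line_graph_edges_def line_graph_vertices_def)
qed

theorem theorem3p4:
  fixes P V :: "complex set" and E :: "complex set set" and n :: nat
  assumes "crease_pattern P V E"
    and "flat_foldable P E"
    and "determined_by_line_graph P V E"
    and "n = card (graph_components (line_graph_vertices P V E) (line_graph_edges P V E))"
  shows "card (local_MVs P V E) = 2 ^ n"
proof -
  let ?W = "line_graph_vertices P V E" and ?G = "line_graph_edges P V E"
  obtain h where h: "bij_betw h (proper_2_colorings ?W ?G) (local_MVs P V E)"
    using assms(3) by (auto simp: determined_by_line_graph_def)
  have "local_MVs P V E \<noteq> {}"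
    using assms(2) valid_MVs_subset_local_MVs[OF assms(1)] by (auto simp: flat_foldable_def)
  then have "proper_2_colorings ?W ?G \<noteq> {}"
    using h by (auto simp: bij_betw_def)
  then have "card (proper_2_colorings ?W ?G) = 2 ^ n"
    using card_proper_2_colorings[OF finite_line_graph_vertices line_graph_edges_subset]
      finite_creases[OF assms(1)] assms(4) by blast
  then show ?thesis
    using bij_betw_same_card[OF h] by simp
qed

end
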